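(* Let $\alpha\in(0,\pi)$, let $\nu$ be a compactly supported probability measure on $\mathbb{R}$ symmetric about $0$, let $(\sigma_N)_{N\ge1}$ be a sequence of positive reals, and for each $N$ let $(\mathbf{Z},\mathbf{X})$ be sampled from $\mathrm{GLMM}_N(\alpha,\nu,\sigma_N)$. Assume that there is $\rho\in(0,1]$ such that $\liminf_{u\downarrow0}\nu([-u,u])/u^{\rho}>0$. Then there exists a constant $c>0$, depending only on $\alpha$ and $\nu$, such that $$\min_{\mathbf{t}\in\mathcal{T}}\mathbb{E}\left[\mathrm{Ham}^*(\mathbf{t}(\mathbf{X}),\mathbf{Z})\right]\ \ge\ c\,N\,(\sigma_N\wedge 1)^{\rho}$$ for all sufficiently large $N$, where $\mathcal{T}$ is the set of measurable maps $\mathbf{t}:(\mathbb{R}^2)^N\to\{1,2\}^N$. Consequently, exact recovery is impossible (no sequence of estimators achieves it) if $\sigma_N\not\ll N^{-1/\rho}$, and almost exact recovery is impossible if $\sigma_N\not\ll 1$.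
   Context: Model: let $L_1,L_2\subset\mathbb{R}^2$ be lines through the origin intersecting at angle $\alpha$, and let $\mathbf{v}_1,\mathbf{v}_2$ be unit vectors spanning $L_1,L_2$. $(\mathbf{Z},\mathbf{X})\sim\mathrm{GLMM}_N(\alpha,\nu,\sigma)$ (Gaussian line mixture model) means: $\mathbf{Z}=(Z_1,\dots,Z_N)$ with $Z_i$ uniform on $\{1,2\}$, and $\mathbf{X}=(\mathbf{X}_1,\dots,\mathbf{X}_N)$ with $\mathbf{X}_i=V_i\mathbf{v}_{Z_i}+\sigma\mathbf{Y}_i\in\mathbb{R}^2$, where $V_i\sim\nu$, $\mathbf{Y}_i\sim N(0,I_2)$, and all $Z_i,V_i,\mathbf{Y}_i$ are mutually independent. Hamming distance: $\mathrm{Ham}(\mathbf{z},\mathbf{w})=\sum_{i=1}^N 1(z_i\ne w_i)$, and $\mathrm{Ham}^*(\mathbf{z},\mathbf{w})=\min\{\mathrm{Ham}(\mathbf{z},\mathbf{w}),N-\mathrm{Ham}(\mathbf{z},\mathbf{w})\}$. An estimator (one measurable map $\mathbf{t}:(\mathbb{R}^2)^N\to\{1,2\}^N$ for each $N$) achieves exact recovery if $\lim_{N\to\infty}\mathbb{E}[\mathrm{Ham}^*(\mathbf{t}(\mathbf{X}),\mathbf{Z})]=0$, and almost exact recovery if $\lim_{N\to\infty}N^{-1}\mathbb{E}[\mathrm{Ham}^*(\mathbf{t}(\mathbf{X}),\mathbf{Z})]=0$. For positive sequences, $a_N\ll b_N$ means $\lim_{N\to\infty} a_N/b_N=0$, and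 $a_N\not\ll b_N$ is its negation. $a\wedge b=\min\{a,b\}$. *)

theory Defs
  imports "HOL-Probability.Probability"
begin

definition lines_at_angle :: "(real^2) set \<Rightarrow> (real^2) set \<Rightarrow> real \<Rightarrow> bool" where
  "lines_at_angle L1 L2 \<alpha> \<longleftrightarrow>
     (\<exists>u1 u2. norm u1 = 1 \<and> norm u2 = 1 \<and> L1 = span {u1} \<and> L2 = span {u2} \<and> arccos (u1 \<bullet> u2) = \<alpha>)"

definition compactly_supported :: "real measure \<Rightarrow> bool" where
  "compactly_supported \<nu> \<longleftrightarrow> (\<exists>K. compact K \<and> measure \<nu> K = 1)"

definition symmetric_about_0 :: "real measure \<Rightarrow> bool" where
  "symmetric_about_0 \<nu> \<longleftrightarrow> distr \<nu> borel uminus = \<nu>"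

definition std_gaussian2 :: "(real^2) measure" where
  "std_gaussian2 = density lborel (\<lambda>y. ennreal (\<Prod>b\<in>Basis. std_normal_density (y \<bullet> b)))"

(* The joint law of one triple (Z_i, V_i, Y_i). *)
definition latent :: "real measure \<Rightarrow> (nat \<times> real \<times> (real^2)) measure" where
  "latent \<nu> = uniform_count_measure {1, 2} \<Otimes>\<^sub>M (\<nu> \<Otimes>\<^sub>M std_gaussian2)"

abbreviation label_space :: "nat \<Rightarrow> (nat \<Rightarrow> nat) measure" where
  "label_space N \<equiv> (\<Pi>\<^sub>M i\<in>{1..N}. count_space {1, 2})"

abbreviation sample_space :: "nat \<Rightarrow> (nat \<Rightarrow> real^2) measure" where
  "sample_space N \<equiv> (\<Pi>\<^sub>M i\<in>{1..N}. borel)"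

(* The joint law of (Z, X).  Only v1, v2 enter; the angle is a property of the lines they span. *)
definition GLMM ::
  "nat \<Rightarrow> real^2 \<Rightarrow> real^2 \<Rightarrow> real measure \<Rightarrow> real \<Rightarrow> ((nat \<Rightarrow> nat) \<times> (nat \<Rightarrow> real^2)) measure" where
  "GLMM N v1 v2 \<nu> s =
     distr (\<Pi>\<^sub>M i\<in>{1..N}. latent \<nu>) (label_space N \<Otimes>\<^sub>M sample_space N)
       (\<lambda>\<omega>. (\<lambda>i\<in>{1..N}. fst (\<omega> i),
             \<lambda>i\<in>{1..N}. case \<omega> i of (z, v, y) \<Rightarrow> v *\<^sub>R (if z = 1 then v1 else v2) + s *\<^sub>R y))"

definition Ham :: "nat \<Rightarrow> (nat \<Rightarrow> nat) \<Rightarrow> (nat \<Rightarrow> nat) \<Rightarrow> real" where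
  "Ham N z w = (\<Sum>i=1..N. of_bool (z i \<noteq> w i))"

definition Ham_star :: "nat \<Rightarrow> (nat \<Rightarrow> nat) \<Rightarrow> (nat \<Rightarrow> nat) \<Rightarrow> real" where
  "Ham_star N z w = min (Ham N z w) (real N - Ham N z w)"

abbreviation estimators :: "nat \<Rightarrow> ((nat \<Rightarrow> real^2) \<Rightarrow> (nat \<Rightarrow> nat)) set" where
  "estimators N \<equiv> measurable (sample_space N) (label_space N)"

definition risk ::
  "nat \<Rightarrow> real^2 \<Rightarrow> real^2 \<Rightarrow> real measure \<Rightarrow> real \<Rightarrow> ((nat \<Rightarrow> real^2) \<Rightarrow> (nat \<Rightarrow> nat)) \<Rightarrow> real" where
  "risk N v1 v2 \<nu> s t = (\<integral>(z, x). Ham_star N (t x) z \<partial>GLMM N v1 v2 \<nu> s)"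

definition exact_recovery ::
  "real^2 \<Rightarrow> real^2 \<Rightarrow> real measure \<Rightarrow> (nat \<Rightarrow> real) \<Rightarrow> (nat \<Rightarrow> (nat \<Rightarrow> real^2) \<Rightarrow> (nat \<Rightarrow> nat)) \<Rightarrow> bool" where
  "exact_recovery v1 v2 \<nu> \<sigma> t \<longleftrightarrow>
     (\<lambda>N. risk N v1 v2 \<nu> (\<sigma> N) (t N)) \<longlonglongrightarrow> 0"

definition almost_exact_recovery ::
  "real^2 \<Rightarrow> real^2 \<Rightarrow> real measure \<Rightarrow> (nat \<Rightarrow> real) \<Rightarrow> (nat \<Rightarrow> (nat \<Rightarrow> real^2) \<Rightarrow> (nat \<Rightarrow> nat)) \<Rightarrow> bool" where
  "almost_exact_recovery v1 v2 \<nu> \<sigma> t \<longleftrightarrow>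
     (\<lambda>N. risk N v1 v2 \<nu> (\<sigma> N) (t N) / real N) \<longlonglongrightarrow> 0"

definition much_less :: "(nat \<Rightarrow> real) \<Rightarrow> (nat \<Rightarrow> real) \<Rightarrow> bool" (infix \<open>\<lless>\<close> 50) where
  "a \<lless> b \<longleftrightarrow> (\<lambda>N. a N / b N) \<longlonglongrightarrow> 0"

lemma prob_space_std_gaussian2: "prob_space std_gaussian2"
proof -
  have "(\<integral>\<^sup>+y. ennreal (\<Prod>b\<in>Basis. std_normal_density (y \<bullet> b)) \<partial>(lborel :: (real^2) measure))
      = (\<integral>\<^sup>+y. (\<Prod>b\<in>Basis. ennreal (std_normal_density (y \<bullet> b))) \<partial>(lborel :: (real^2) measure))"
    by (intro nn_integral_cong) (simp add: prod_ennreal)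
  also have "\<dots> = (\<Prod>b\<in>(Basis :: (real^2) set). \<integral>\<^sup>+y. ennreal (std_normal_density y) \<partial>lborel)"
    by (rule nn_integral_lborel_prod) auto
  also have "(\<integral>\<^sup>+y. ennreal (std_normal_density y) \<partial>lborel) = 1"
    using prob_space.emeasure_space_1[OF prob_space_normal_density[of 1 0]]
    by (simp add: emeasure_density)
  finally show ?thesis
    by (intro prob_spaceI) (simp add: std_gaussian2_def emeasure_density)
qed

lemma measurable_GLMM_map:
  assumes "sets \<nu> = sets borel"
  shows "(\<lambda>\<omega>. (\<lambda>i\<in>{1..N}. fst (\<omega> i),
             \<lambda>i\<in>{1..N}. case \<omega> i of (z, v, y) \<Rightarrow> v *\<^sub>R (if z = 1 then v1 else v2) + s *\<^sub>R y))
    \<in> measurable (\<Pi>\<^sub>M i\<in>{1..N}. latent \<nu>) (label_space N \<Otimes>\<^sub>M sample_space N)"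
proof -
  have latent: "sets (latent \<nu>) = sets (count_space {1, 2} \<Otimes>\<^sub>M (borel \<Otimes>\<^sub>M borel))"
    unfolding latent_def using assms
    by (intro sets_pair_measure_cong) (auto simp: sets_uniform_count_measure std_gaussian2_def)
  have fst: "fst \<in> measurable (latent \<nu>) (count_space {1, 2})"
    unfolding measurable_cong_sets[OF latent refl] by measurable
  have "(\<lambda>(z :: nat, v :: real, y :: real^2). v *\<^sub>R (if z = 1 then v1 else v2) + s *\<^sub>R y)
      \<in> borel_measurable (latent \<nu>)"
    unfolding measurable_cong_sets[OF latent refl] by measurable
  with fst show ?thesis
    by (intro measurable_Pair measurable_restrict)
       (auto intro: measurable_compose[OF measurable_component_singleton])
qed

lemma prob_space_GLMM:
  assumes "real_distribution \<nu>"
  shows "prob_space (GLMM N v1 v2 \<nu> s)"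
proof -
  interpret \<nu>: real_distribution \<nu> by (rule assms)
  interpret G: prob_space std_gaussian2 by (rule prob_space_std_gaussian2)
  interpret Z: prob_space "uniform_count_measure {1, 2 :: nat}"
    by (rule prob_space_uniform_count_measure) auto
  interpret VY: pair_prob_space \<nu> std_gaussian2 ..
  interpret ZVY: pair_prob_space "uniform_count_measure {1, 2 :: nat}" "\<nu> \<Otimes>\<^sub>M std_gaussian2" ..
  have "prob_space (latent \<nu>)"
    unfolding latent_def by (rule ZVY.prob_space_axioms)
  then have "prob_space (\<Pi>\<^sub>M i\<in>{1..N}. latent \<nu>)"
    by (intro prob_space_PiM)
  then show ?thesis
    unfolding GLMM_def by (rule prob_space.prob_space_distr) (rule measurable_GLMM_map, simp)
qed

end

theory Submission
  imports Defs
begin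

text \<open>
  If the coefficient \<open>V\<close> of a sample satisfies \<open>\<bar>V\<bar> \<le> s\<close>, its point on the line lies within one noise
  level \<open>s\<close> of the intersection point of the lines, so neither label can be excluded. Quantitatively, a
  standard Gaussian translated by a vector of norm at most one has a density that is bounded below on
  the unit cube by a constant independent of the translation (\<open>gaussian_dominates_cube\<close>). Whatever
  rule guesses the label of such a sample errs there for one of the two labels, and hence every
  rule errs with probability at least a constant times \<open>\<nu> [-s, s]\<close> (\<open>single_sample_error\<close>). The
  small-ball condition makes this at least a constant times \<open>(s \<and> 1)\<^sup>\<rho>\<close>
  (\<open>small_ball_lower_bound\<close>).

  The difficulty is the minimum in \<open>Ham_star\<close>: many wrong labels cost nothing if almost all labels are
  wrong. The remedy is to group the samples into \<open>N div 2\<close> disjoint pairs. A pair with exactly one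
  wrong label contributes one to the number of wrong labels and also one to the number of correct
  labels, hence one to their minimum (\<open>Ham_star_ge_split_pairs\<close>). For a pair \<open>(i, j)\<close>, freeze
  everything except sample \<open>i\<close>. Flipping \<open>Z_i\<close> without moving \<open>X_i\<close> switches the event that the
  pair has exactly one wrong label on or off. This event therefore says that some rule based on
  \<open>X_i\<close> misses \<open>Z_i\<close>, and its probability is bounded by the error for a single sample
  (\<open>split_pair_probability\<close>). Summing over the pairs gives a risk of order \<open>N (s \<and> 1)\<^sup>\<rho>\<close> for every
  estimator as soon as \<open>N \<ge> 2\<close>.

  The minimum of the risk is attained because there are finitely many label vectors: an estimator that
  minimises the posterior expected loss for each observation is measurable and optimal
  (\<open>bayes_rule_exists\<close>). The two impossibility claims follow from the bound by reading it as
  \<open>risk / c \<ge> (min 1 (s N^(1/\<rho>)))\<^sup>\<rho>\<close> and \<open>risk / (c N) \<ge> (min 1 s)\<^sup>\<rho>\<close>.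
\<close>

section \<open>Existence of Bayes estimators\<close>

text \<open>
  The risk of \<open>t\<close> is the integral over the observation of the posterior expected loss of \<open>t x\<close>, where
  the unnormalised posterior weight of a label \<open>z\<close> is the Radon--Nikodym derivative of the law of
  the observation on the event that the label is \<open>z\<close>. As \<open>A\<close> is finite, the integrand can be
  minimised separately at each \<open>x\<close>. Breaking ties by the first index in an enumeration of \<open>A\<close> keeps
  the minimiser measurable.
\<close>
lemma bayes_rule_exists:
  fixes loss :: "'a \<Rightarrow> 'a \<Rightarrow> ennreal"
  assumes "finite_measure P" and sets_P: "sets P = sets (count_space A \<Otimes>\<^sub>M S)"
    and "finite A" "A \<noteq> {}"
  shows "\<exists>t\<in>measurable S (count_space A). \<forall>t'\<in>measurable S (count_space A).
    (\<integral>\<^sup>+p. loss (t (snd p)) (fst p) \<partial>P) \<le> (\<integral>\<^sup>+p. loss (t' (snd p)) (fst p) \<partial>P)"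
proof -
  interpret P: finite_measure P by fact
  note [measurable_cong] = sets_P
  have space_P: "space P = A \<times> space S"
    using sets_eq_imp_space_eq[OF sets_P] by (simp add: space_pair_measure)
  define M where "M = distr P S snd"
  define joint where "joint z = distr (density P (\<lambda>p. indicator {z} (fst p))) S snd" for z
  define post where "post z = RN_deriv M (joint z)" for z
  define expected_loss where "expected_loss w x = (\<Sum>z\<in>A. post z x * loss w z)" for w x
  have snd_P [measurable]: "snd \<in> measurable P S" by measurable
  have fst_P [measurable]: "fst \<in> measurable P (count_space A)" by measurable
  have sets_M [measurable_cong]: "sets M = sets S" by (simp add: M_def)
  interpret M: finite_measure M unfolding M_def by (rule P.finite_measure_distr) simp
  have ind [measurable]: "(\<lambda>p. indicator {z} (fst p) :: ennreal) \<in> borel_measurable P" for z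
    by (rule measurable_compose[OF fst_P]) simp
  have ac: "absolutely_continuous M (joint z)" for z
    unfolding absolutely_continuous_def
  proof
    fix B assume B: "B \<in> null_sets M"
    then have BS [measurable]: "B \<in> sets S" by (auto simp: M_def)
    have "snd -` B \<inter> space P \<in> null_sets P"
      using B BS by (auto simp: M_def null_sets_def emeasure_distr intro!: measurable_sets[OF snd_P])
    then have "snd -` B \<inter> space P \<in> null_sets (density P (\<lambda>p. indicator {z} (fst p)))"
      using absolutely_continuousI_density[OF ind, of z] by (auto simp: absolutely_continuous_def)
    then show "B \<in> null_sets (joint z)"
      using BS by (auto simp: joint_def null_sets_def emeasure_distr)
  qed
  have post [measurable]: "post z \<in> borel_measurable S" for z
    unfolding post_def measurable_cong_sets[OF sets_M refl, symmetric]
    by (rule borel_measurable_RN_deriv)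
  have ell [measurable]: "expected_loss w \<in> borel_measurable S" for w
    unfolding expected_loss_def by measurable
  have risk_eq: "(\<integral>\<^sup>+p. loss (t (snd p)) (fst p) \<partial>P) = (\<integral>\<^sup>+x. expected_loss (t x) x \<partial>M)"
    if t [measurable]: "t \<in> measurable S (count_space A)" for t
  proof -
    have lt [measurable]: "(\<lambda>x. loss (t x) z) \<in> borel_measurable S" for z
      by (rule measurable_compose[OF t]) simp
    have "(\<integral>\<^sup>+p. loss (t (snd p)) (fst p) \<partial>P)
        = (\<integral>\<^sup>+p. (\<Sum>z\<in>A. indicator {z} (fst p) * loss (t (snd p)) z) \<partial>P)"
    proof (rule nn_integral_cong)
      fix p assume "p \<in> space P"
      then have "fst p \<in> A" by (auto simp: space_P)
      then have "(\<Sum>z\<in>A. indicator {z} (fst p) * loss (t (snd p)) z)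
          = (\<Sum>z\<in>A. if z = fst p then loss (t (snd p)) z else 0)"
        by (intro sum.cong) (auto simp: indicator_def)
      also have "\<dots> = loss (t (snd p)) (fst p)"
        using \<open>finite A\<close> \<open>fst p \<in> A\<close> by simp
      finally show "loss (t (snd p)) (fst p) = (\<Sum>z\<in>A. indicator {z} (fst p) * loss (t (snd p)) z)"
        by simp
    qed
    also have "\<dots> = (\<Sum>z\<in>A. \<integral>\<^sup>+p. indicator {z} (fst p) * loss (t (snd p)) z \<partial>P)"
      by (rule nn_integral_sum) measurable
    also have "\<dots> = (\<Sum>z\<in>A. \<integral>\<^sup>+x. post z x * loss (t x) z \<partial>M)"
    proof (rule sum.cong[OF refl])
      fix z
      have "(\<integral>\<^sup>+p. indicator {z} (fst p) * loss (t (snd p)) z \<partial>P) = (\<integral>\<^sup>+x. loss (t x) z \<partial>joint z)"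
        by (simp add: joint_def nn_integral_distr nn_integral_density)
      also have "\<dots> = (\<integral>\<^sup>+x. post z x * loss (t x) z \<partial>M)"
        unfolding post_def
        by (rule M.RN_deriv_nn_integral[OF ac]) (simp_all add: joint_def M_def)
      finally show "(\<integral>\<^sup>+p. indicator {z} (fst p) * loss (t (snd p)) z \<partial>P)
          = (\<integral>\<^sup>+x. post z x * loss (t x) z \<partial>M)" .
    qed
    also have "\<dots> = (\<integral>\<^sup>+x. expected_loss (t x) x \<partial>M)"
      unfolding expected_loss_def by (rule nn_integral_sum[symmetric]) measurable
    finally show ?thesis .
  qed
  obtain e where e: "bij_betw e {0..<card A} A"
    using ex_bij_betw_nat_finite[OF \<open>finite A\<close>] by blast
  define best where
    "best x = (LEAST k. k < card A \<and> (\<forall>j<card A. expected_loss (e k) x \<le> expected_loss (e j) x))" for x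
  have best: "best x < card A \<and> (\<forall>j<card A. expected_loss (e (best x)) x \<le> expected_loss (e j) x)" for x
  proof -
    have "\<exists>k. k < card A \<and> (\<forall>j<card A. expected_loss (e k) x \<le> expected_loss (e j) x)"
      using ex_min_if_finite[of "(\<lambda>k. expected_loss (e k) x) ` {..<card A}"] \<open>finite A\<close> \<open>A \<noteq> {}\<close>
      by (force simp: card_gt_0_iff not_less)
    then show ?thesis unfolding best_def by (rule LeastI_ex)
  qed
  have best_meas: "best \<in> measurable S (count_space UNIV)"
    unfolding best_def by measurable
  have best_in: "e (best x) \<in> A" for x
    using best[of x] bij_betwE[OF e] by auto
  have t [measurable]: "(\<lambda>x. e (best x)) \<in> measurable S (count_space A)"
    using measurable_compose[OF best_meas, of e "count_space UNIV"] best_in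
    by (auto intro: measurable_count_space_extend simp: measurable_def)
  show ?thesis
  proof (intro bexI[OF _ t] ballI)
    fix t' assume t': "t' \<in> measurable S (count_space A)"
    have "expected_loss (e (best x)) x \<le> expected_loss (t' x) x" if "x \<in> space M" for x
    proof -
      have "t' x \<in> A"
        using measurable_space[OF t'] that by (simp add: M_def)
      then obtain j where "j < card A" "t' x = e j"
        using e by (force simp: bij_betw_def)
      then show ?thesis using best[of x] by simp
    qed
    then show "(\<integral>\<^sup>+p. loss (e (best (snd p))) (fst p) \<partial>P) \<le> (\<integral>\<^sup>+p. loss (t' (snd p)) (fst p) \<partial>P)"
      unfolding risk_eq[OF t] risk_eq[OF t'] by (rule nn_integral_mono)
  qed
qed

section \<open>Hamming distance up to a global flip\<close>

lemma Ham_nonneg: "0 \<le> Ham N z w"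
  by (simp add: Ham_def sum_nonneg)

lemma Ham_le: "Ham N z w \<le> real N"
  using sum_bounded_above[of "{1..N}" "\<lambda>i. of_bool (z i \<noteq> w i)" "1::real"] by (simp add: Ham_def)

lemma sum_consecutive_pairs_le:
  fixes g :: "nat \<Rightarrow> real"
  assumes "\<And>i. 0 \<le> g i"
  shows "(\<Sum>k=1..N div 2. g (2 * k - 1) + g (2 * k)) \<le> (\<Sum>i=1..N. g i)"
proof -
  have "(\<Sum>k=1..m. g (2 * k - 1) + g (2 * k)) = (\<Sum>i=1..2 * m. g i)" for m
    by (induction m) auto
  then show ?thesis
    using assms by (simp only:) (rule sum_mono2, auto)
qed

text \<open>
  A pair with exactly one error contains one wrong and one correct label, so the number of such pairs
  bounds both arguments of the minimum.
\<close>
lemma Ham_star_ge_split_pairs: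
  "(\<Sum>k=1..N div 2. of_bool ((z (2*k-1) \<noteq> w (2*k-1)) \<noteq> (z (2*k) \<noteq> w (2*k)))) \<le> Ham_star N z w"
proof -
  define err :: "nat \<Rightarrow> real" where "err i = of_bool (z i \<noteq> w i)" for i
  let ?split = "\<lambda>k. of_bool ((z (2*k-1) \<noteq> w (2*k-1)) \<noteq> (z (2*k) \<noteq> w (2*k))) :: real"
  have "(\<Sum>k=1..N div 2. ?split k) \<le> (\<Sum>k=1..N div 2. err (2*k-1) + err (2*k))"
    by (intro sum_mono) (auto simp: err_def)
  also have "\<dots> \<le> Ham N z w"
    unfolding Ham_def err_def[symmetric] by (rule sum_consecutive_pairs_le) (simp add: err_def)
  finally have 1: "(\<Sum>k=1..N div 2. ?split k) \<le> Ham N z w" .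
  have "(\<Sum>k=1..N div 2. ?split k) \<le> (\<Sum>k=1..N div 2. (1 - err (2*k-1)) + (1 - err (2*k)))"
    by (intro sum_mono) (auto simp: err_def)
  also have "\<dots> \<le> (\<Sum>i=1..N. 1 - err i)"
    by (rule sum_consecutive_pairs_le) (simp add: err_def)
  also have "\<dots> = real N - Ham N z w"
    by (simp add: Ham_def err_def sum_subtractf)
  finally show ?thesis using 1 by (simp add: Ham_star_def)
qed

section \<open>Error probability for a single sample\<close>

lemma std_normal_density_shift_lower:
  assumes "0 \<le> x" "x \<le> 1" "\<bar>c\<bar> \<le> 1"
  shows "std_normal_density 2 \<le> std_normal_density (x - c)"
proof -
  have "\<bar>x - c\<bar> \<le> \<bar>2\<bar>" using assms by linarith
  then have "(x - c)\<^sup>2 \<le> 2\<^sup>2" by (simp only: abs_le_square_iff)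
  then show ?thesis by (simp add: std_normal_density_def divide_right_mono)
qed

text \<open>
  A point of the unit cube has coordinates in \<open>[0, 1]\<close>, and a translation of norm at most one moves
  each of them by at most one, so all coordinates stay in \<open>[-1, 2]\<close>, where the one-dimensional normal
  density is smallest at 2.
\<close>
definition shifted_density_bound :: real where
  "shifted_density_bound = (\<Prod>b\<in>(Basis :: (real^2) set). std_normal_density 2)"

lemma shifted_density_bound_pos: "0 < shifted_density_bound"
  unfolding shifted_density_bound_def by (intro prod_pos) (auto simp: std_normal_density_def)

text \<open>
  The lower bound does not depend on the translation \<open>a\<close>. This makes the laws of the observation
  under the two labels comparable: they have a common part of fixed mass.
\<close>
lemma gaussian_dominates_cube:
  fixes a :: "real^2" and f :: "real^2 \<Rightarrow> ennreal"
  assumes [measurable]: "f \<in> borel_measurable borel" and a: "norm a \<le> 1"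
  shows "(\<integral>\<^sup>+w. ennreal shifted_density_bound * indicator (cbox 0 One) w * f w \<partial>lborel)
    \<le> (\<integral>\<^sup>+y. f (a + y) \<partial>std_gaussian2)"
proof -
  let ?d = "\<lambda>y :: real^2. \<Prod>b\<in>Basis. std_normal_density (y \<bullet> b)"
  have "(\<integral>\<^sup>+w. ennreal shifted_density_bound * indicator (cbox 0 One) w * f w \<partial>lborel)
      \<le> (\<integral>\<^sup>+w. ennreal (?d (w - a)) * f w \<partial>lborel)"
  proof (rule nn_integral_mono)
    fix w :: "real^2"
    show "ennreal shifted_density_bound * indicator (cbox 0 One) w * f w \<le> ennreal (?d (w - a)) * f w"
    proof (cases "w \<in> cbox 0 One")
      case True
      have "shifted_density_bound \<le> ?d (w - a)"
        unfolding shifted_density_bound_def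
      proof (rule prod_mono)
        fix b :: "real^2" assume b: "b \<in> Basis"
        have "0 \<le> w \<bullet> b" "w \<bullet> b \<le> 1"
          using True b by (auto simp: mem_box)
        moreover have "\<bar>a \<bullet> b\<bar> \<le> 1"
          using Basis_le_norm[OF b, of a] a by linarith
        ultimately show "0 \<le> std_normal_density 2 \<and> std_normal_density 2 \<le> std_normal_density ((w - a) \<bullet> b)"
          using std_normal_density_shift_lower by (simp add: inner_diff_left)
      qed
      then show ?thesis using True by (simp add: mult_right_mono ennreal_leI)
    qed simp
  qed
  also have "\<dots> = (\<integral>\<^sup>+w. ennreal (?d (w - a)) * f w \<partial>distr lborel borel ((+) a))"
    by (simp add: lborel_distr_plus)
  also have "\<dots> = (\<integral>\<^sup>+y. ennreal (?d y) * f (a + y) \<partial>lborel)"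
    by (subst nn_integral_distr) (auto intro!: borel_measurable_prod)
  also have "\<dots> = (\<integral>\<^sup>+y. f (a + y) \<partial>std_gaussian2)"
    unfolding std_gaussian2_def by (subst nn_integral_density) auto
  finally show ?thesis .
qed

definition observation :: "real^2 \<Rightarrow> real^2 \<Rightarrow> real \<Rightarrow> nat \<times> real \<times> (real^2) \<Rightarrow> real^2" where
  "observation v1 v2 s = (\<lambda>(z, v, y). v *\<^sub>R (if z = 1 then v1 else v2) + s *\<^sub>R y)"

lemma sets_latent:
  assumes "sets \<nu> = sets borel"
  shows "sets (latent \<nu>) = sets (count_space {1, 2} \<Otimes>\<^sub>M (borel \<Otimes>\<^sub>M borel))"
  unfolding latent_def using assms
  by (intro sets_pair_measure_cong) (auto simp: sets_uniform_count_measure std_gaussian2_def)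

lemma measurable_observation:
  assumes "sets \<nu> = sets borel"
  shows "observation v1 v2 s \<in> borel_measurable (latent \<nu>)"
  unfolding measurable_cong_sets[OF sets_latent[OF assms] refl] observation_def by measurable

lemma prob_space_latent:
  assumes "real_distribution \<nu>"
  shows "prob_space (latent \<nu>)"
proof -
  interpret \<nu>: real_distribution \<nu> by (rule assms)
  interpret G: prob_space std_gaussian2 by (rule prob_space_std_gaussian2)
  interpret Z: prob_space "uniform_count_measure {1, 2 :: nat}"
    by (rule prob_space_uniform_count_measure) auto
  interpret VY: pair_prob_space \<nu> std_gaussian2 ..
  interpret ZVY: pair_prob_space "uniform_count_measure {1, 2 :: nat}" "\<nu> \<Otimes>\<^sub>M std_gaussian2" ..
  show ?thesis unfolding latent_def by (rule ZVY.prob_space_axioms)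
qed

lemma nn_integral_latent:
  assumes "real_distribution \<nu>" and f: "f \<in> borel_measurable (latent \<nu>)"
  shows "(\<integral>\<^sup>+\<omega>. f \<omega> \<partial>latent \<nu>)
    = ennreal (1/2) * (\<integral>\<^sup>+v. (\<integral>\<^sup>+y. f (1, v, y) \<partial>std_gaussian2) + (\<integral>\<^sup>+y. f (2, v, y) \<partial>std_gaussian2) \<partial>\<nu>)"
proof -
  interpret \<nu>: real_distribution \<nu> by (rule assms)
  interpret G: prob_space std_gaussian2 by (rule prob_space_std_gaussian2)
  interpret VY: pair_prob_space \<nu> std_gaussian2 ..
  let ?Z = "uniform_count_measure {1, 2 :: nat}"
  note f' [measurable] = f[unfolded latent_def]
  have m: "(\<lambda>p. f (z, p)) \<in> borel_measurable (\<nu> \<Otimes>\<^sub>M std_gaussian2)" if "z \<in> {1, 2}" for z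
    by (rule measurable_compose[OF measurable_Pair1' f']) (use that in \<open>simp add: space_uniform_count_measure\<close>)
  have VY: "(\<integral>\<^sup>+p. f (z, p) \<partial>(\<nu> \<Otimes>\<^sub>M std_gaussian2)) = (\<integral>\<^sup>+v. \<integral>\<^sup>+y. f (z, v, y) \<partial>std_gaussian2 \<partial>\<nu>)"
    if "z \<in> {1, 2}" for z
    using G.nn_integral_fst[OF m[OF that]] by simp
  have mv: "(\<lambda>v. \<integral>\<^sup>+y. f (z, v, y) \<partial>std_gaussian2) \<in> borel_measurable \<nu>" if "z \<in> {1, 2}" for z
    using G.borel_measurable_nn_integral_fst[OF m[OF that]] by simp
  have "(\<integral>\<^sup>+\<omega>. f \<omega> \<partial>latent \<nu>) = (\<integral>\<^sup>+z. \<integral>\<^sup>+p. f (z, p) \<partial>(\<nu> \<Otimes>\<^sub>M std_gaussian2) \<partial>?Z)"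
    unfolding latent_def by (rule VY.nn_integral_fst[OF f', symmetric])
  also have "\<dots> = ennreal (1/2) * (\<integral>\<^sup>+p. f (1, p) \<partial>(\<nu> \<Otimes>\<^sub>M std_gaussian2))
      + ennreal (1/2) * (\<integral>\<^sup>+p. f (2, p) \<partial>(\<nu> \<Otimes>\<^sub>M std_gaussian2))"
    unfolding uniform_count_measure_def by (subst nn_integral_point_measure_finite) auto
  also have "\<dots> = ennreal (1/2) * (\<integral>\<^sup>+v. (\<integral>\<^sup>+y. f (1, v, y) \<partial>std_gaussian2)
      + (\<integral>\<^sup>+y. f (2, v, y) \<partial>std_gaussian2) \<partial>\<nu>)"
    by (simp add: VY nn_integral_add mv distrib_left)
  finally show ?thesis .
qed

text \<open>
  The set \<open>E\<close> is the region in which a rule answers 2, so the event is that the rule is wrong. Given a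
  coefficient \<open>v\<close> of size at most \<open>s\<close>, the observation is \<open>s\<close> times a Gaussian translated by
  \<open>(v / s) v1\<close> or \<open>(v / s) v2\<close>, both of norm at most one. Before the scaling by \<open>s\<close>, both laws
  dominate the same multiple of the uniform law on the cube, and at each of its points the rule is wrong for exactly one of the two labels.
\<close>
lemma single_sample_error:
  assumes \<nu>: "real_distribution \<nu>" and "0 < s" and E [measurable]: "E \<in> sets borel"
    and v: "norm v1 = 1" "norm v2 = 1"
  shows "ennreal (shifted_density_bound / 2 * measure \<nu> {-s..s})
    \<le> (\<integral>\<^sup>+\<omega>. of_bool ((fst \<omega> = 1) = (observation v1 v2 s \<omega> \<in> E)) \<partial>latent \<nu>)"
proof -
  interpret \<nu>: real_distribution \<nu> by (rule \<nu>)
  note sl [measurable_cong] = sets_latent[OF \<nu>.events_eq_borel]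
  have [measurable]: "observation v1 v2 s \<in> borel_measurable (latent \<nu>)"
    by (rule measurable_observation) simp
  let ?f = "\<lambda>\<omega>. of_bool ((fst \<omega> = (1::nat)) = (observation v1 v2 s \<omega> \<in> E)) :: ennreal"
  have f: "?f \<in> borel_measurable (latent \<nu>)" by measurable
  let ?Q = "cbox 0 One :: (real^2) set"
  define g where "g w = (of_bool (s *\<^sub>R w \<in> E) :: ennreal)" for w
  have g [measurable]: "g \<in> borel_measurable borel" "(\<lambda>w. 1 - g w) \<in> borel_measurable borel"
    unfolding g_def by measurable
  have key: "ennreal shifted_density_bound \<le> (\<integral>\<^sup>+y. ?f (1, v, y) \<partial>std_gaussian2) + (\<integral>\<^sup>+y. ?f (2, v, y) \<partial>std_gaussian2)"
    if "v \<in> {-s..s}" for v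
  proof -
    have small: "norm ((v / s) *\<^sub>R u) \<le> 1" if "norm u = 1" for u :: "real^2"
      using that \<open>v \<in> {-s..s}\<close> \<open>0 < s\<close> by (simp add: abs_le_iff divide_le_eq)
    have scale: "s *\<^sub>R ((v / s) *\<^sub>R u + y) = v *\<^sub>R u + s *\<^sub>R y" for u y :: "real^2"
      using \<open>0 < s\<close> by (simp add: scaleR_add_right)
    \<comment> \<open>Split the cube into the part scaled into \<open>E\<close>, wrong for label 1, and the rest, wrong for label 2.\<close>
    have "ennreal shifted_density_bound = (\<integral>\<^sup>+w. ennreal shifted_density_bound * indicator ?Q w \<partial>lborel)"
      by (simp add: nn_integral_cmult_indicator emeasure_lborel_cbox_eq)
    also have "\<dots> = (\<integral>\<^sup>+w. ennreal shifted_density_bound * indicator ?Q w * g w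
        + ennreal shifted_density_bound * indicator ?Q w * (1 - g w) \<partial>lborel)"
      by (rule nn_integral_cong) (simp add: g_def of_bool_def)
    also have "\<dots> = (\<integral>\<^sup>+w. ennreal shifted_density_bound * indicator ?Q w * g w \<partial>lborel)
        + (\<integral>\<^sup>+w. ennreal shifted_density_bound * indicator ?Q w * (1 - g w) \<partial>lborel)"
      by (rule nn_integral_add) measurable
    also have "\<dots> \<le> (\<integral>\<^sup>+y. g ((v / s) *\<^sub>R v1 + y) \<partial>std_gaussian2)
        + (\<integral>\<^sup>+y. 1 - g ((v / s) *\<^sub>R v2 + y) \<partial>std_gaussian2)"
      by (intro add_mono gaussian_dominates_cube g small v)
    also have "\<dots> = (\<integral>\<^sup>+y. ?f (1, v, y) \<partial>std_gaussian2) + (\<integral>\<^sup>+y. ?f (2, v, y) \<partial>std_gaussian2)"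
      by (intro arg_cong2[where f = "(+)"] nn_integral_cong)
         (auto simp: g_def scale observation_def)
    finally show ?thesis .
  qed
  have "ennreal (shifted_density_bound / 2 * measure \<nu> {-s..s})
      = ennreal (1/2) * (\<integral>\<^sup>+v. ennreal shifted_density_bound * indicator {-s..s} v \<partial>\<nu>)"
  proof -
    have "(\<integral>\<^sup>+v. ennreal shifted_density_bound * indicator {-s..s} v \<partial>\<nu>) = ennreal (shifted_density_bound * measure \<nu> {-s..s})"
      using shifted_density_bound_pos
      by (simp add: nn_integral_cmult_indicator \<nu>.emeasure_eq_measure ennreal_mult)
    then show ?thesis
      using shifted_density_bound_pos by (simp only:) (subst ennreal_mult[symmetric], auto)
  qed
  also have "\<dots> \<le> (\<integral>\<^sup>+\<omega>. ?f \<omega> \<partial>latent \<nu>)"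
    unfolding nn_integral_latent[OF \<nu> f]
    by (intro mult_left_mono nn_integral_mono) (use key in \<open>auto simp: indicator_def\<close>)
  finally show ?thesis .
qed

section \<open>Measurability and attainment of the minimal risk\<close>

lemma label_space_eq: "label_space N = count_space ({1..N} \<rightarrow>\<^sub>E {1, 2})"
  by (rule count_space_PiM_finite) auto

lemma sets_GLMM: "sets (GLMM N v1 v2 \<nu> s) = sets (label_space N \<Otimes>\<^sub>M sample_space N)"
  by (simp add: GLMM_def)

lemma measurable_label:
  assumes "i \<in> {1..N}"
  shows "(\<lambda>z. z i) \<in> measurable (label_space N) (count_space UNIV)"
  unfolding label_space_eq by simp

lemma measurable_error:
  assumes t: "t \<in> estimators N" and i: "i \<in> {1..N}"
  shows "Measurable.pred (label_space N \<Otimes>\<^sub>M sample_space N) (\<lambda>p. t (snd p) i \<noteq> fst p i)"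
proof -
  have [measurable]:
    "(\<lambda>p. t (snd p) i) \<in> measurable (label_space N \<Otimes>\<^sub>M sample_space N) (count_space UNIV)"
    "(\<lambda>p. fst p i) \<in> measurable (label_space N \<Otimes>\<^sub>M sample_space N) (count_space UNIV)"
    using measurable_compose[OF measurable_compose[OF measurable_snd t] measurable_label[OF i]]
      measurable_compose[OF measurable_fst measurable_label[OF i]] by auto
  \<comment> \<open>Correct labelling is a countable union of events that fix estimate and label separately.\<close>
  have "(\<lambda>p. t (snd p) i \<noteq> fst p i) = (\<lambda>p. \<not> (\<exists>k. t (snd p) i = k \<and> fst p i = k))"
    by auto
  then show ?thesis by (simp only:) measurable
qed

lemma measurable_Ham_star:
  assumes t: "t \<in> estimators N"
  shows "(\<lambda>p. Ham_star N (t (snd p)) (fst p)) \<in> borel_measurable (label_space N \<Otimes>\<^sub>M sample_space N)"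
proof -
  have "(\<lambda>p. of_bool (t (snd p) i \<noteq> fst p i) :: real)
      \<in> borel_measurable (label_space N \<Otimes>\<^sub>M sample_space N)" if "i \<in> {1..N}" for i
    using measurable_error[OF t that] by measurable
  then have "(\<lambda>p. Ham N (t (snd p)) (fst p)) \<in> borel_measurable (label_space N \<Otimes>\<^sub>M sample_space N)"
    unfolding Ham_def by (rule borel_measurable_sum)
  then show ?thesis unfolding Ham_star_def by measurable
qed

lemma Ham_star_bounds: "0 \<le> Ham_star N z w" "Ham_star N z w \<le> real N"
  using Ham_nonneg[of N z w] Ham_le[of N z w] by (auto simp: Ham_star_def)

lemma risk_nonneg: "0 \<le> risk N v1 v2 \<nu> s t"
  unfolding risk_def by (rule Bochner_Integration.integral_nonneg) (simp add: split_beta' Ham_star_bounds)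

lemma ennreal_risk:
  assumes \<nu>: "real_distribution \<nu>" and t: "t \<in> estimators N"
  shows "ennreal (risk N v1 v2 \<nu> s t)
    = (\<integral>\<^sup>+p. ennreal (Ham_star N (t (snd p)) (fst p)) \<partial>GLMM N v1 v2 \<nu> s)"
proof -
  interpret prob_space "GLMM N v1 v2 \<nu> s" using \<nu> by (rule prob_space_GLMM)
  have "(\<lambda>p. Ham_star N (t (snd p)) (fst p)) \<in> borel_measurable (GLMM N v1 v2 \<nu> s)"
    using measurable_Ham_star[OF t] by (simp cong: measurable_cong_sets add: sets_GLMM)
  then have "integrable (GLMM N v1 v2 \<nu> s) (\<lambda>p. Ham_star N (t (snd p)) (fst p))"
    by (rule integrable_const_bound[where B = "real N", rotated]) (simp add: Ham_star_bounds)
  then show ?thesis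
    unfolding risk_def by (subst nn_integral_eq_integral) (auto simp: Ham_star_bounds split_beta')
qed

lemma minimal_risk_attained:
  assumes \<nu>: "real_distribution \<nu>"
  shows "\<exists>t\<in>estimators N. is_arg_min (risk N v1 v2 \<nu> s) (\<lambda>t. t \<in> estimators N) t"
proof -
  interpret prob_space "GLMM N v1 v2 \<nu> s" using \<nu> by (rule prob_space_GLMM)
  let ?A = "{1..N} \<rightarrow>\<^sub>E {1, 2 :: nat}"
  have sets_eq: "sets (GLMM N v1 v2 \<nu> s) = sets (count_space ?A \<Otimes>\<^sub>M sample_space N)"
    unfolding sets_GLMM label_space_eq ..
  have fin: "finite ?A" and ne: "?A \<noteq> {}" by (auto simp: finite_PiE PiE_eq_empty_iff)
  obtain t where t: "t \<in> estimators N" and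
    min: "\<forall>t'\<in>estimators N. (\<integral>\<^sup>+p. ennreal (Ham_star N (t (snd p)) (fst p)) \<partial>GLMM N v1 v2 \<nu> s)
      \<le> (\<integral>\<^sup>+p. ennreal (Ham_star N (t' (snd p)) (fst p)) \<partial>GLMM N v1 v2 \<nu> s)"
    unfolding label_space_eq
    using bayes_rule_exists[OF finite_measure_axioms sets_eq fin ne] by (rule bexE)
  have "risk N v1 v2 \<nu> s t \<le> risk N v1 v2 \<nu> s t'" if t': "t' \<in> estimators N" for t'
    using bspec[OF min t'] unfolding ennreal_risk[OF \<nu> t, symmetric] ennreal_risk[OF \<nu> t', symmetric]
    by (simp only: ennreal_le_iff[OF risk_nonneg])
  with t show ?thesis
    by (intro bexI[of _ t]) (simp_all add: is_arg_min_linorder)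
qed

section \<open>The lower bound on the risk\<close>

text \<open>
  With all other samples fixed, let \<open>E\<close> be the set of values of \<open>X_i\<close> for which the pair has exactly
  one error when \<open>Z_i = 1\<close>. The estimated labels and the error at \<open>j\<close> do not change when \<open>Z_i\<close> is
  flipped and \<open>X_i\<close> is kept, while the error at \<open>i\<close> is toggled because the estimate is 1 or 2. For
  \<open>Z_i = 2\<close> the pair has exactly one error precisely outside \<open>E\<close>, which is the event of
  \<open>single_sample_error\<close>.
\<close>
lemma split_pair_probability:
  assumes \<nu>: "real_distribution \<nu>" and "0 < s" and v: "norm v1 = 1" "norm v2 = 1"
    and t: "t \<in> estimators N" and i: "i \<in> {1..N}" and j: "j \<in> {1..N}" "j \<noteq> i"
  shows "ennreal (shifted_density_bound / 2 * measure \<nu> {-s..s})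
    \<le> (\<integral>\<^sup>+p. of_bool ((t (snd p) i \<noteq> fst p i) \<noteq> (t (snd p) j \<noteq> fst p j)) \<partial>GLMM N v1 v2 \<nu> s)"
proof -
  interpret \<nu>: real_distribution \<nu> by (rule \<nu>)
  interpret L: prob_space "latent \<nu>" by (rule prob_space_latent[OF \<nu>])
  interpret Pr: product_prob_space "\<lambda>_. latent \<nu>" "{1..N}" ..
  let ?I = "{1..N} - {i}"
  interpret PI: prob_space "\<Pi>\<^sub>M k\<in>?I. latent \<nu>" by (rule prob_space_PiM) (rule L.prob_space_axioms)
  let ?obs = "observation v1 v2 s"
  let ?F = "\<lambda>\<omega>. (\<lambda>k\<in>{1..N}. fst (\<omega> k), \<lambda>k\<in>{1..N}. ?obs (\<omega> k))"
  have F: "?F \<in> measurable (\<Pi>\<^sub>M k\<in>{1..N}. latent \<nu>) (label_space N \<Otimes>\<^sub>M sample_space N)"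
    using measurable_GLMM_map[of \<nu> N v1 v2 s] by (simp add: observation_def)
  have tm [measurable]: "(\<lambda>x. t x k) \<in> measurable (sample_space N) (count_space UNIV)"
    if "k \<in> {1..N}" for k
    using measurable_compose[OF t measurable_label[OF that]] by simp
  let ?split = "\<lambda>p. of_bool ((t (snd p) i \<noteq> fst p i) \<noteq> (t (snd p) j \<noteq> fst p j)) :: ennreal"
  have split: "?split \<in> borel_measurable (label_space N \<Otimes>\<^sub>M sample_space N)"
    using measurable_error[OF t i] measurable_error[OF t j(1)] by measurable
  have "(\<integral>\<^sup>+p. ?split p \<partial>GLMM N v1 v2 \<nu> s)
      = (\<integral>\<^sup>+\<omega>. ?split (?F \<omega>) \<partial>(\<Pi>\<^sub>M k\<in>{1..N}. latent \<nu>))"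
    unfolding GLMM_def observation_def[symmetric] using F split
    by (subst nn_integral_distr) (auto simp: observation_def)
  also have "\<dots> = (\<integral>\<^sup>+\<omega>. (\<integral>\<^sup>+y. ?split (?F (fun_upd \<omega> i y)) \<partial>latent \<nu>) \<partial>(\<Pi>\<^sub>M k\<in>?I. latent \<nu>))"
  proof -
    have ins: "insert i ?I = {1..N}" using i by auto
    have fin: "finite ?I" "i \<notin> ?I" by auto
    have "(\<lambda>\<omega>. ?split (?F \<omega>)) \<in> borel_measurable (\<Pi>\<^sub>M k\<in>insert i ?I. latent \<nu>)"
      unfolding ins by (rule measurable_compose[OF F split])
    from Pr.product_nn_integral_insert[OF fin this] show ?thesis
      by (simp only: ins)
  qed
  finally have eq: "(\<integral>\<^sup>+p. ?split p \<partial>GLMM N v1 v2 \<nu> s)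
      = (\<integral>\<^sup>+\<omega>. (\<integral>\<^sup>+y. ?split (?F (fun_upd \<omega> i y)) \<partial>latent \<nu>) \<partial>(\<Pi>\<^sub>M k\<in>?I. latent \<nu>))" .
  have inner: "ennreal (shifted_density_bound / 2 * measure \<nu> {-s..s}) \<le> (\<integral>\<^sup>+y. ?split (?F (fun_upd \<omega> i y)) \<partial>latent \<nu>)"
    for \<omega>
  proof -
    define X where "X u = (\<lambda>k\<in>{1..N}. if k = i then u else ?obs (\<omega> k))" for u
    define E where "E = {u. (t (X u) i \<noteq> 1) \<noteq> (t (X u) j \<noteq> fst (\<omega> j))}"
    have X [measurable]: "X \<in> measurable borel (sample_space N)"
      unfolding X_def by (rule measurable_restrict) auto
    have [measurable]: "(\<lambda>u. t (X u) k) \<in> measurable borel (count_space UNIV)" if "k \<in> {1..N}" for k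
      by (rule measurable_compose[OF X tm[OF that]])
    have "E \<in> sets borel"
      unfolding E_def using i j by measurable
    from single_sample_error[OF \<nu> \<open>0 < s\<close> this v]
    show ?thesis
    proof (rule order_trans, intro nn_integral_mono)
      fix y assume "y \<in> space (latent \<nu>)"
      then have y: "fst y \<in> {1, 2}"
        unfolding sets_eq_imp_space_eq[OF sets_latent[OF \<nu>.events_eq_borel]]
        by (auto simp: space_pair_measure)
      have snd: "snd (?F (fun_upd \<omega> i y)) = X (?obs y)"
        by (auto simp: X_def)
      have "X (?obs y) \<in> space (sample_space N)"
        by (rule measurable_space[OF X]) simp
      then have "t (X (?obs y)) i \<in> {1, 2}"
        using measurable_space[OF t] i by (fastforce simp: space_PiM PiE_def Pi_def)
      with y show "of_bool ((fst y = 1) = (?obs y \<in> E)) \<le> ?split (?F (fun_upd \<omega> i y))"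
        unfolding snd using i j by (auto simp: E_def)
    qed
  qed
  have "ennreal (shifted_density_bound / 2 * measure \<nu> {-s..s})
      = (\<integral>\<^sup>+\<omega>. ennreal (shifted_density_bound / 2 * measure \<nu> {-s..s}) \<partial>(\<Pi>\<^sub>M k\<in>?I. latent \<nu>))"
    unfolding nn_integral_const PI.emeasure_space_1 by simp
  also have "\<dots> \<le> (\<integral>\<^sup>+p. ?split p \<partial>GLMM N v1 v2 \<nu> s)"
    unfolding eq by (intro nn_integral_mono inner)
  finally show ?thesis .
qed

lemma risk_lower_bound:
  assumes \<nu>: "real_distribution \<nu>" and "0 < s" and v: "norm v1 = 1" "norm v2 = 1"
    and t: "t \<in> estimators N"
  shows "real (N div 2) * (shifted_density_bound / 2 * measure \<nu> {-s..s}) \<le> risk N v1 v2 \<nu> s t"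
proof -
  let ?G = "GLMM N v1 v2 \<nu> s"
  let ?b = "shifted_density_bound / 2 * measure \<nu> {-s..s}"
  let ?split = "\<lambda>k p. (t (snd p) (2*k-1) \<noteq> fst p (2*k-1)) \<noteq> (t (snd p) (2*k) \<noteq> fst p (2*k))"
  have [measurable]: "(\<lambda>p. of_bool (?split k p) :: ennreal) \<in> borel_measurable ?G" if "k \<in> {1..N div 2}" for k
  proof -
    have "2*k-1 \<in> {1..N}" "2*k \<in> {1..N}" using that by auto
    from this[THEN measurable_error[OF t]] show ?thesis
      unfolding measurable_cong_sets[OF sets_GLMM refl] by measurable
  qed
  have b: "0 \<le> ?b" using shifted_density_bound_pos by simp
  have "ennreal (real n * r) = (\<Sum>k=1..n. ennreal r)" if "0 \<le> r" for n :: nat and r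
    using that by (simp add: ennreal_mult ennreal_of_nat_eq_real_of_nat)
  from this[OF b] have "ennreal (real (N div 2) * ?b) = (\<Sum>k=1..N div 2. ennreal ?b)" .
  also have "\<dots> \<le> (\<Sum>k=1..N div 2. \<integral>\<^sup>+p. of_bool (?split k p) \<partial>?G)"
    by (intro sum_mono split_pair_probability assms) auto
  also have "\<dots> = (\<integral>\<^sup>+p. (\<Sum>k=1..N div 2. of_bool (?split k p)) \<partial>?G)"
    by (rule nn_integral_sum[symmetric]) measurable
  also have "\<dots> \<le> (\<integral>\<^sup>+p. ennreal (Ham_star N (t (snd p)) (fst p)) \<partial>?G)"
  proof (rule nn_integral_mono)
    fix p
    have "(\<Sum>k=1..N div 2. of_bool (?split k p) :: ennreal)
        = ennreal (\<Sum>k=1..N div 2. of_bool (?split k p))"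
      by (subst sum_ennreal[symmetric], simp) (rule sum.cong[OF refl],
        simp only: of_bool_def split: if_split, simp)
    also have "\<dots> \<le> ennreal (Ham_star N (t (snd p)) (fst p))"
      by (rule ennreal_leI) (rule Ham_star_ge_split_pairs)
    finally show "(\<Sum>k=1..N div 2. of_bool (?split k p)) \<le> ennreal (Ham_star N (t (snd p)) (fst p))" .
  qed
  also have "\<dots> = ennreal (risk N v1 v2 \<nu> s t)"
    by (rule ennreal_risk[OF \<nu> t, symmetric])
  finally have "ennreal (real (N div 2) * ?b) \<le> ennreal (risk N v1 v2 \<nu> s t)" .
  then show ?thesis by (simp only: ennreal_le_iff[OF risk_nonneg])
qed

text \<open>
  The condition on the limit inferior controls small \<open>u\<close> only. For larger \<open>u \<le> 1\<close>, monotonicity of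
  \<open>u \<mapsto> \<nu> [-u, u]\<close> and \<open>u powr \<rho> \<le> 1\<close> extend the bound at the price of the factor \<open>d powr \<rho>\<close>.
\<close>
lemma small_ball_lower_bound:
  assumes \<nu>: "real_distribution \<nu>" and "0 < \<rho>"
    and lim: "Liminf (at_right 0) (\<lambda>u. ereal (measure \<nu> {-u..u} / u powr \<rho>)) > 0"
  shows "\<exists>c>0. \<forall>u. 0 < u \<and> u \<le> 1 \<longrightarrow> c * u powr \<rho> \<le> measure \<nu> {-u..u}"
proof -
  interpret \<nu>: real_distribution \<nu> by (rule \<nu>)
  obtain y where y: "0 < y" "\<forall>\<^sub>F u in at_right 0. y < ereal (measure \<nu> {-u..u} / u powr \<rho>)"
    using dense[OF lim] by (blast dest: less_LiminfD)
  obtain a where a: "0 < a" "ereal a \<le> y"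
    using y(1) by (cases y) (auto intro: that[of 1])
  obtain d0 where d0: "0 < d0" "\<And>u. 0 < u \<Longrightarrow> u < d0 \<Longrightarrow> y < ereal (measure \<nu> {-u..u} / u powr \<rho>)"
    using y(2) by (auto simp: eventually_at_right_field)
  have near: "a * u powr \<rho> \<le> measure \<nu> {-u..u}" if "0 < u" "u < d0" for u
  proof -
    have "ereal a < ereal (measure \<nu> {-u..u} / u powr \<rho>)"
      using d0(2)[OF that] a(2) by (rule le_less_trans[rotated])
    then show ?thesis using that by (simp add: less_divide_eq)
  qed
  define d where "d = min 1 (d0 / 2)"
  have d: "0 < d" "d < d0" "d \<le> 1" using d0(1) by (auto simp: d_def)
  have dp: "0 < d powr \<rho>" "d powr \<rho> \<le> 1"
    using d \<open>0 < \<rho>\<close> by (auto simp: powr_le1)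
  show ?thesis
  proof (intro exI[of _ "a * d powr \<rho>"] conjI allI impI)
    show "0 < a * d powr \<rho>" using a dp by simp
    fix u :: real assume u: "0 < u \<and> u \<le> 1"
    have up: "0 \<le> u powr \<rho>" "u powr \<rho> \<le> 1" using u \<open>0 < \<rho>\<close> by (auto simp: powr_le1)
    show "a * d powr \<rho> * u powr \<rho> \<le> measure \<nu> {-u..u}"
    proof (cases "u < d0")
      case True
      have "a * d powr \<rho> * u powr \<rho> \<le> a * 1 * u powr \<rho>"
        using a dp up by (intro mult_mono) auto
      also have "\<dots> \<le> measure \<nu> {-u..u}" using near u True by simp
      finally show ?thesis .
    next
      case False
      have "a * d powr \<rho> * u powr \<rho> \<le> a * d powr \<rho> * 1"
        using a dp up by (intro mult_mono) auto
      also have "\<dots> \<le> measure \<nu> {-d..d}" using near d by simp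
      also have "\<dots> \<le> measure \<nu> {-u..u}"
        using False d by (intro \<nu>.finite_measure_mono) auto
      finally show ?thesis .
    qed
  qed
qed

section \<open>Impossibility of recovery\<close>

lemma tendsto_0_if_min_1_tendsto_0:
  fixes f :: "nat \<Rightarrow> real"
  assumes "(\<lambda>n. min (f n) 1) \<longlonglongrightarrow> 0"
  shows "f \<longlonglongrightarrow> 0"
proof -
  have "\<forall>\<^sub>F n in sequentially. min (f n) 1 < 1"
    using assms by (rule order_tendstoD) simp
  then have "\<forall>\<^sub>F n in sequentially. min (f n) 1 = f n"
    by eventually_elim (simp add: min_def split: if_splits)
  then show ?thesis using assms by (rule Lim_transform_eventually[rotated])
qed

lemma tendsto_0_if_powr_tendsto_0:
  fixes f :: "nat \<Rightarrow> real"
  assumes "(\<lambda>n. f n powr \<rho>) \<longlonglongrightarrow> 0" "0 < \<rho>" "\<forall>\<^sub>F n in sequentially. 0 \<le> f n"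
  shows "f \<longlonglongrightarrow> 0"
proof -
  have "(\<lambda>n. (f n powr \<rho>) powr (1 / \<rho>)) \<longlonglongrightarrow> 0"
    using assms by (intro tendsto_zero_powrI[OF assms(1) tendsto_const]) (auto)
  moreover have "\<forall>\<^sub>F n in sequentially. (f n powr \<rho>) powr (1 / \<rho>) = f n"
    using assms(3) by eventually_elim (use \<open>0 < \<rho>\<close> in \<open>simp add: powr_powr\<close>)
  ultimately show ?thesis by (rule Lim_transform_eventually)
qed

theorem theorem1:
  fixes \<alpha> \<rho> :: real and \<nu> :: "real measure"
  assumes "0 < \<alpha>" "\<alpha> < pi"
    and "real_distribution \<nu>" "compactly_supported \<nu>" "symmetric_about_0 \<nu>"
    and "0 < \<rho>" "\<rho> \<le> 1"
    and "Liminf (at_right 0) (\<lambda>u. ereal (measure \<nu> {-u..u} / u powr \<rho>)) > 0"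
  shows "\<exists>c>0. \<forall>L1 L2 v1 v2 \<sigma>.
    lines_at_angle L1 L2 \<alpha> \<and>
    norm v1 = 1 \<and> span {v1} = L1 \<and> norm v2 = 1 \<and> span {v2} = L2 \<and>
    (\<forall>N\<ge>1. \<sigma> N > 0) \<longrightarrow>
      (\<forall>\<^sub>F N in sequentially. \<exists>t\<in>estimators N.
         is_arg_min (risk N v1 v2 \<nu> (\<sigma> N)) (\<lambda>t. t \<in> estimators N) t \<and>
         risk N v1 v2 \<nu> (\<sigma> N) t \<ge> c * real N * (min (\<sigma> N) 1) powr \<rho>) \<and>
      (\<not> \<sigma> \<lless> (\<lambda>N. real N powr (- 1 / \<rho>)) \<longrightarrow>
         \<not> (\<exists>t. (\<forall>N\<ge>1. t N \<in> estimators N) \<and> exact_recovery v1 v2 \<nu> \<sigma> t)) \<and>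
      (\<not> \<sigma> \<lless> (\<lambda>N. 1) \<longrightarrow>
         \<not> (\<exists>t. (\<forall>N\<ge>1. t N \<in> estimators N) \<and> almost_exact_recovery v1 v2 \<nu> \<sigma> t))"
proof -
  interpret \<nu>: real_distribution \<nu> by fact
  obtain a where a: "0 < a" "\<And>u. 0 < u \<Longrightarrow> u \<le> 1 \<Longrightarrow> a * u powr \<rho> \<le> measure \<nu> {-u..u}"
    using small_ball_lower_bound[OF assms(3,6,8)] by blast
  \<comment> \<open>The denominator 6 combines the factor 1/2 of \<open>risk_lower_bound\<close> with \<open>N div 2 \<ge> N / 3\<close> for \<open>N \<ge> 2\<close>.\<close>
  define c where "c = shifted_density_bound * a / 6"
  have c: "0 < c" using a shifted_density_bound_pos by (simp add: c_def)
  have bound: "c * real N * (min s 1) powr \<rho> \<le> risk N v1 v2 \<nu> s t"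
    if "2 \<le> N" "0 < s" "norm v1 = 1" "norm v2 = 1" "t \<in> estimators N" for N s v1 v2 t
  proof -
    have "a * (min s 1) powr \<rho> \<le> measure \<nu> {- min s 1..min s 1}"
      using that by (intro a) auto
    also have "\<dots> \<le> measure \<nu> {-s..s}"
      by (intro \<nu>.finite_measure_mono) auto
    finally have m: "a * (min s 1) powr \<rho> \<le> measure \<nu> {-s..s}" .
    have "N \<le> 3 * (N div 2)"
      using \<open>2 \<le> N\<close> by presburger
    then have "real N \<le> 3 * real (N div 2)" by linarith
    then have "c * real N * (min s 1) powr \<rho> \<le> c * (3 * real (N div 2)) * (min s 1) powr \<rho>"
      using c by (intro mult_right_mono mult_left_mono) auto
    also have "\<dots> = real (N div 2) * (shifted_density_bound / 2 * (a * (min s 1) powr \<rho>))"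
      by (simp add: c_def)
    also have "\<dots> \<le> real (N div 2) * (shifted_density_bound / 2 * measure \<nu> {-s..s})"
      using m shifted_density_bound_pos by (intro mult_left_mono) auto
    also have "\<dots> \<le> risk N v1 v2 \<nu> s t"
      by (rule risk_lower_bound) fact+
    finally show ?thesis .
  qed
  show ?thesis
  proof (intro exI[of _ c] conjI c allI impI; elim conjE)
    fix L1 L2 and v1 v2 :: "real^2" and \<sigma> :: "nat \<Rightarrow> real"
    assume v: "norm v1 = 1" "norm v2 = 1" and \<sigma>: "\<forall>N\<ge>1. 0 < \<sigma> N"
    show "\<forall>\<^sub>F N in sequentially. \<exists>t\<in>estimators N.
         is_arg_min (risk N v1 v2 \<nu> (\<sigma> N)) (\<lambda>t. t \<in> estimators N) t \<and>
         risk N v1 v2 \<nu> (\<sigma> N) t \<ge> c * real N * (min (\<sigma> N) 1) powr \<rho>"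
      using eventually_ge_at_top[of 2]
    proof eventually_elim
      case (elim N)
      with \<sigma> have "0 < \<sigma> N" by simp
      obtain t where t: "t \<in> estimators N"
        "is_arg_min (risk N v1 v2 \<nu> (\<sigma> N)) (\<lambda>t. t \<in> estimators N) t"
        using minimal_risk_attained[OF assms(3)] by (rule bexE)
      show ?case
        by (intro bexI[of _ t] conjI t bound elim \<open>0 < \<sigma> N\<close> v)
    qed
    have bound': "(min (\<sigma> N) 1) powr \<rho> * real N \<le> risk N v1 v2 \<nu> (\<sigma> N) (t N) / c"
      if "2 \<le> N" "\<forall>N\<ge>1. t N \<in> estimators N" for N t
    proof -
      have "c * real N * (min (\<sigma> N) 1) powr \<rho> \<le> risk N v1 v2 \<nu> (\<sigma> N) (t N)"
        by (rule bound[OF that(1) _ v]) (use that \<sigma> in \<open>simp_all del: One_nat_def\<close>)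
      then show ?thesis using c by (simp add: le_divide_eq mult_ac)
    qed
    show "\<not> (\<exists>t. (\<forall>N\<ge>1. t N \<in> estimators N) \<and> exact_recovery v1 v2 \<nu> \<sigma> t)"
      if "\<not> \<sigma> \<lless> (\<lambda>N. real N powr (- 1 / \<rho>))"
    proof
      assume "\<exists>t. (\<forall>N\<ge>1. t N \<in> estimators N) \<and> exact_recovery v1 v2 \<nu> \<sigma> t"
      then obtain t where t: "\<forall>N\<ge>1. t N \<in> estimators N"
        and lim: "(\<lambda>N. risk N v1 v2 \<nu> (\<sigma> N) (t N)) \<longlonglongrightarrow> 0"
        unfolding exact_recovery_def by (elim exE conjE)
      \<comment> \<open>Since \<open>N powr (1/\<rho>) \<ge> 1\<close>, truncating after the rescaling gives a smaller value than truncating before.\<close>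
      let ?r = "\<lambda>N. \<sigma> N * real N powr (1 / \<rho>)"
      have "(\<lambda>N. min (?r N) 1 powr \<rho>) \<longlonglongrightarrow> 0"
      proof (rule tendsto_sandwich[OF _ _ tendsto_const tendsto_divide_zero[OF lim, of c]])
        show "\<forall>\<^sub>F N in sequentially. min (?r N) 1 powr \<rho> \<le> risk N v1 v2 \<nu> (\<sigma> N) (t N) / c"
          using eventually_ge_at_top[of 2]
        proof eventually_elim
          case (elim N)
          let ?n = "real N powr (1 / \<rho>)"
          have n: "1 \<le> ?n" using elim \<open>0 < \<rho>\<close> by (intro ge_one_powr_ge_zero) auto
          have "0 < \<sigma> N" using \<sigma> elim by simp
          have "min (?r N) 1 \<le> min (\<sigma> N) 1 * ?n"
            using n by (cases "\<sigma> N \<le> 1") auto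
          then have "min (?r N) 1 powr \<rho> \<le> (min (\<sigma> N) 1 * ?n) powr \<rho>"
            using \<open>0 < \<sigma> N\<close> \<open>0 < \<rho>\<close> by (intro powr_mono2) auto
          also have "\<dots> = min (\<sigma> N) 1 powr \<rho> * real N"
            using \<open>0 < \<sigma> N\<close> \<open>0 < \<rho>\<close> by (simp add: powr_mult powr_powr)
          also have "\<dots> \<le> risk N v1 v2 \<nu> (\<sigma> N) (t N) / c" using bound'[OF elim t] .
          finally show ?case .
        qed
      qed auto
      moreover have "\<forall>\<^sub>F N in sequentially. 0 \<le> min (?r N) 1"
        using eventually_ge_at_top[of 1]
      proof eventually_elim
        case (elim N)
        with \<sigma> have "0 < \<sigma> N" by blast
        then show ?case by simp
      qed
      ultimately have "(\<lambda>N. min (?r N) 1) \<longlonglongrightarrow> 0"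
        by (rule tendsto_0_if_powr_tendsto_0[OF _ \<open>0 < \<rho>\<close>])
      then have "?r \<longlonglongrightarrow> 0" by (rule tendsto_0_if_min_1_tendsto_0)
      then have "\<sigma> \<lless> (\<lambda>N. real N powr (- 1 / \<rho>))"
        by (simp add: much_less_def powr_minus divide_inverse)
      with that show False by blast
    qed
    show "\<not> (\<exists>t. (\<forall>N\<ge>1. t N \<in> estimators N) \<and> almost_exact_recovery v1 v2 \<nu> \<sigma> t)"
      if "\<not> \<sigma> \<lless> (\<lambda>N. 1)"
    proof
      assume "\<exists>t. (\<forall>N\<ge>1. t N \<in> estimators N) \<and> almost_exact_recovery v1 v2 \<nu> \<sigma> t"
      then obtain t where t: "\<forall>N\<ge>1. t N \<in> estimators N"
        and lim: "(\<lambda>N. risk N v1 v2 \<nu> (\<sigma> N) (t N) / real N) \<longlonglongrightarrow> 0"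
        unfolding almost_exact_recovery_def by (elim exE conjE)
      have "(\<lambda>N. min (\<sigma> N) 1 powr \<rho>) \<longlonglongrightarrow> 0"
      proof (rule tendsto_sandwich[OF _ _ tendsto_const tendsto_divide_zero[OF lim, of c]])
        show "\<forall>\<^sub>F N in sequentially. min (\<sigma> N) 1 powr \<rho> \<le> risk N v1 v2 \<nu> (\<sigma> N) (t N) / real N / c"
          using eventually_ge_at_top[of 2]
        proof eventually_elim
          case (elim N)
          then show ?case using bound'[OF elim t] c by (simp add: field_simps)
        qed
      qed auto
      moreover have "\<forall>\<^sub>F N in sequentially. 0 \<le> min (\<sigma> N) 1"
        using eventually_ge_at_top[of 1]
      proof eventually_elim
        case (elim N)
        with \<sigma> have "0 < \<sigma> N" by blast
        then show ?case by simp
      qed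
      ultimately have "(\<lambda>N. min (\<sigma> N) 1) \<longlonglongrightarrow> 0"
        by (rule tendsto_0_if_powr_tendsto_0[OF _ \<open>0 < \<rho>\<close>])
      then have "\<sigma> \<longlonglongrightarrow> 0" by (rule tendsto_0_if_min_1_tendsto_0)
      then have "\<sigma> \<lless> (\<lambda>N. 1)" by (simp add: much_less_def)
      with that show False by blast
    qed
  qed
qed

end
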